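(* The numbers $A(n,i,j)$ satisfy $A(1,i,j)=\delta_{i,1}\delta_{0,j}$ and, for $n\ge2$, $$A(n,i,j)=\sum_{k=i}^{n-1}\binom{k}{i-1}\, j\, A(n-1,k,j-1)+(j+1)A(n-1,i-1,j).$$
   Context: A tournament on $\{1,\ldots,n\}$ has, for each pair $i\ne j$, exactly one of the arcs $i\to j$, $j\to i$; an arc $i\to j$ is an ascent if $i<j$, a descent if $i>j$; alternation acyclic means no directed cycle along which ascents and descents alternate. A parent function is $p:\{1,\ldots,n\}\to\{2,\ldots,n\}\cup\{\infty\}$ with $p(i)>i$. For a permutation $\pi$, $T(\pi,p)$ has, for $u<v$, $u\to v$ if $p(u)\ne\infty$ and $\pi^{-1}(v)\ge\pi^{-1}(p(u))$, else $v\to u$. Right-alternating walk order $\preceq$: $u\preceq v$ if $u=v$ or there is a directed walk $u=w_0\to\cdots\to w_{2i}=v$ ($i\ge1$) alternating descent, ascent, …, ending with an ascent. For alternation acyclic $T$, the largest maximal order $\lambda$ is the permutation with $\lambda(k)$ the largest maximal element of $\{\lambda(1),\ldots,\lambda(k)\}$ under the restriction of $\preceq$ for every $k$; the largest maximal representation is $(\lambda,p)$ with $p$ the unique parent function with $T(\lambda,p)=T$ ($p(u)$ = the $v>u$ with $u\to v$ leftmost in $\lambda$, or $\infty$). $T$ has type $(n,i,j)$ if $|p^{-1}(\infty)|=i$ and $|p(\{1,\ldots,n\})|=j+1$ (the range counted including $\infty$). $A(n,i,j)$ is the number of alternation acyclic tournaments on $\{1,\ldots,n\}$ of type $(n,i,j)$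 (zero for indices outside the natural range). $\delta$ is the Kronecker delta. *)

theory Defs
  imports
    Complex_Main
    "HOL-Library.Extended_Nat"
    "HOL-Library.FuncSet"
    "HOL-Combinatorics.Permutations"
begin

text \<open>A tournament is its set of arcs; \<open>(i, j) \<in> T\<close> stands for \<open>i \<rightarrow> j\<close>.\<close>

definition tournament :: "nat \<Rightarrow> nat rel \<Rightarrow> bool" where
  "tournament n T \<longleftrightarrow>
     T \<subseteq> {1..n} \<times> {1..n} \<and> irrefl T \<and>
     (\<forall>i\<in>{1..n}. \<forall>j\<in>{1..n}. i \<noteq> j \<longrightarrow> ((i, j) \<in> T) \<noteq> ((j, i) \<in> T))"

definition ascents :: "nat rel \<Rightarrow> nat rel" where
  "ascents T = {(i, j) \<in> T. i < j}"

definition descents :: "nat rel \<Rightarrow> nat rel" where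
  "descents T = {(i, j) \<in> T. i > j}"

definition cycle_arc :: "nat list \<Rightarrow> nat \<Rightarrow> nat \<times> nat" where
  "cycle_arc c k = (c ! (k mod length c), c ! (Suc k mod length c))"

definition directed_cycle :: "nat rel \<Rightarrow> nat list \<Rightarrow> bool" where
  "directed_cycle T c \<longleftrightarrow>
     c \<noteq> [] \<and> distinct c \<and> (\<forall>k<length c. cycle_arc c k \<in> T)"

text \<open>The alternation is cyclic: the last arc of the cycle is also compared with the first.\<close>

definition alternating_cycle :: "nat rel \<Rightarrow> nat list \<Rightarrow> bool" where
  "alternating_cycle T c \<longleftrightarrow>
     directed_cycle T c \<and>
     (\<forall>k<length c.
        cycle_arc c k \<in> ascents T \<and> cycle_arc c (Suc k) \<in> descents T \<or>
        cycle_arc c k \<in> descents T \<and> cycle_arc c (Suc k) \<in> ascents T)"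

definition alternation_acyclic :: "nat \<Rightarrow> nat rel \<Rightarrow> bool" where
  "alternation_acyclic n T \<longleftrightarrow> tournament n T \<and> \<not> (\<exists>c. alternating_cycle T c)"

text \<open>Parent functions are extensional, i.e. undefined outside \<open>{1..n}\<close>, so that a parent
  function on \<open>{1..n}\<close> is represented by a unique HOL function.\<close>

definition parent_function :: "nat \<Rightarrow> (nat \<Rightarrow> enat) \<Rightarrow> bool" where
  "parent_function n p \<longleftrightarrow>
     p \<in> {1..n} \<rightarrow>\<^sub>E (enat ` {2..n} \<union> {\<infinity>}) \<and> (\<forall>u\<in>{1..n}. p u > enat u)"

definition tournament_of :: "nat \<Rightarrow> (nat \<Rightarrow> nat) \<Rightarrow> (nat \<Rightarrow> enat) \<Rightarrow> nat rel" where
  "tournament_of n \<pi> p =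
     (let leads = (\<lambda>u v. p u \<noteq> \<infinity> \<and> inv \<pi> v \<ge> inv \<pi> (the_enat (p u)))
      in {(u, v). u \<in> {1..n} \<and> v \<in> {1..n} \<and> u < v \<and> leads u v} \<union>
         {(v, u). u \<in> {1..n} \<and> v \<in> {1..n} \<and> u < v \<and> \<not> leads u v})"

definition ra_walk_le :: "nat rel \<Rightarrow> nat \<Rightarrow> nat \<Rightarrow> bool" where
  "ra_walk_le T u v \<longleftrightarrow>
     u = v \<or>
     (\<exists>i\<ge>1. \<exists>w :: nat \<Rightarrow> nat. w 0 = u \<and> w (2 * i) = v \<and>
        (\<forall>k<i. (w (2 * k), w (2 * k + 1)) \<in> descents T \<and>
               (w (2 * k + 1), w (2 * k + 2)) \<in> ascents T))"

definition maximal_elements :: "nat rel \<Rightarrow> nat set \<Rightarrow> nat set" where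
  "maximal_elements T S = {m \<in> S. \<forall>x\<in>S. ra_walk_le T m x \<longrightarrow> x = m}"

definition is_largest_maximal_order :: "nat \<Rightarrow> nat rel \<Rightarrow> (nat \<Rightarrow> nat) \<Rightarrow> bool" where
  "is_largest_maximal_order n T l \<longleftrightarrow>
     l permutes {1..n} \<and> (\<forall>k\<in>{1..n}. l k = Max (maximal_elements T (l ` {1..k})))"

definition largest_maximal_order :: "nat \<Rightarrow> nat rel \<Rightarrow> (nat \<Rightarrow> nat)" where
  "largest_maximal_order n T = (THE l. is_largest_maximal_order n T l)"

text \<open>The second component of the largest maximal representation.\<close>

definition largest_maximal_parent :: "nat \<Rightarrow> nat rel \<Rightarrow> (nat \<Rightarrow> enat)" where
  "largest_maximal_parent n T =
     (THE p. parent_function n p \<and> tournament_of n (largest_maximal_order n T) p = T)"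

text \<open>The indices \<open>i\<close> and \<open>j\<close> range over all integers, so that index shifts in recurrences never
  truncate; out-of-range indices give the number 0.\<close>

definition has_type :: "nat rel \<Rightarrow> nat \<Rightarrow> int \<Rightarrow> int \<Rightarrow> bool" where
  "has_type T n i j \<longleftrightarrow>
     (let p = largest_maximal_parent n T
      in int (card {u \<in> {1..n}. p u = \<infinity>}) = i \<and> int (card (p ` {1..n})) = j + 1)"

definition acyclic_tournament_number :: "nat \<Rightarrow> int \<Rightarrow> int \<Rightarrow> nat" where
  "acyclic_tournament_number n i j = card {T. alternation_acyclic n T \<and> has_type T n i j}"

text \<open>Binomial coefficient with the convention that it vanishes for a negative lower index.
  It is meant for \<open>k \<ge> 0\<close>; upper indices \<open>k < 0\<close> are clipped to 0.\<close>

definition int_binomial :: "int \<Rightarrow> int \<Rightarrow> int" where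
  "int_binomial k m = (if m < 0 then 0 else int (nat k choose nat m))"

end

(* In an alternation acyclic tournament, "descent then ascent" is already a transitive relation: a
   failure of transitivity would close an alternating 4-cycle. A representation (pi, p) of the
   tournament is the largest maximal one exactly when every descent bottom pi(k+1) < pi(k) is the
   parent of some vertex, since this says that pi(k) is not maximal once pi(k+1) is present. So
   tournaments correspond to pairs (pi, p) with this property. For fixed p, inserting n+1 into a
   permutation of 1..n is allowed at the end or in front of an element of the range of p, which
   gives as many choices as the range of p on 1..n has elements (infinity standing for the end).
   A parent function on 1..n+1 arises from one on 1..n by choosing the set X of roots that become
   children of n+1; the two terms of the recurrence are the cases of X nonempty and X empty. *)

theory Submission
  imports Defs
begin

section \<open>The descent-ascent relation and the walk order\<close>

definition alt_step :: "nat rel \<Rightarrow> nat rel" where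
  "alt_step T = descents T O ascents T"

lemma alt_step_iff:
  "(u, w) \<in> alt_step T \<longleftrightarrow> (\<exists>v. (u, v) \<in> T \<and> v < u \<and> (v, w) \<in> T \<and> v < w)"
  by (auto simp: alt_step_def descents_def ascents_def)

lemma tournament_asym: "tournament n T \<Longrightarrow> (u, v) \<in> T \<Longrightarrow> (v, u) \<notin> T"
  unfolding tournament_def irrefl_def by (metis (no_types, lifting) mem_Sigma_iff subsetD)

lemma tournament_dom: "tournament n T \<Longrightarrow> (u, v) \<in> T \<Longrightarrow> u \<in> {1..n} \<and> v \<in> {1..n}"
  unfolding tournament_def by blast

lemma tournament_total:
  "tournament n T \<Longrightarrow> u \<in> {1..n} \<Longrightarrow> v \<in> {1..n} \<Longrightarrow> u \<noteq> v \<Longrightarrow> (u, v) \<in> T \<or> (v, u) \<in> T"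
  unfolding tournament_def by blast

lemma no_alternating_4_cycle:
  assumes "alternation_acyclic n T"
    and arcs: "(u, v) \<in> T" "(v, w) \<in> T" "(w, x) \<in> T" "(x, u) \<in> T"
    and less: "v < u" "v < w" "x < w" "x < u"
  shows False
proof -
  have "tournament n T"
    using assms(1) by (simp add: alternation_acyclic_def)
  \<comment> \<open>The inequalities already separate the low vertices \<open>v\<close>,
    \<open>x\<close> from the high ones \<open>u\<close>, \<open>w\<close>. If two opposite vertices
    coincided, both arcs between a pair would be present.\<close>
  then have "u \<noteq> w" "v \<noteq> x"
    using arcs tournament_asym by blast+
  then have "distinct [u, v, w, x]"
    using less by auto
  \<comment> \<open>Index 4 wraps around to the first arc; it serves as the successor of the arc
    with index 3.\<close>
  moreover have "cycle_arc [u, v, w, x] 0 = (u, v)" "cycle_arc [u, v, w, x] 1 = (v, w)"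
    "cycle_arc [u, v, w, x] 2 = (w, x)" "cycle_arc [u, v, w, x] 3 = (x, u)"
    "cycle_arc [u, v, w, x] 4 = (u, v)"
    by (simp_all add: cycle_arc_def)
  moreover have "k = 0 \<and> Suc k = 1 \<or> k = 1 \<and> Suc k = 2 \<or> k = 2 \<and> Suc k = 3 \<or> k = 3 \<and> Suc k = 4"
    if "k < length [u, v, w, x]" for k
    using that by auto
  ultimately have "alternating_cycle T [u, v, w, x]"
    using arcs less unfolding alternating_cycle_def directed_cycle_def ascents_def descents_def
    by (smt (verit) case_prodI list.distinct(1) mem_Collect_eq)
  then show False
    using assms(1) by (auto simp: alternation_acyclic_def)
qed

text \<open>A path \<open>u\<close>, \<open>v\<close>, \<open>w\<close>, \<open>x\<close>,
  \<open>y\<close> of two steps is shortened by keeping one of its low vertices. If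
  \<open>v < y\<close>, then \<open>v\<close> is a midpoint between \<open>u\<close> and
  \<open>y\<close>, since an arc from \<open>y\<close> to \<open>v\<close> would close the
  alternating cycle \<open>y\<close>, \<open>v\<close>, \<open>w\<close>, \<open>x\<close>.
  Otherwise \<open>x < y \<le> v < u\<close>, and \<open>x\<close> is a midpoint, since an arc from
  \<open>x\<close> to \<open>u\<close> would close the cycle \<open>u\<close>, \<open>v\<close>,
  \<open>w\<close>, \<open>x\<close>.\<close>

lemma alt_step_trans:
  assumes "alternation_acyclic n T" "(u, w) \<in> alt_step T" "(w, y) \<in> alt_step T"
  shows "(u, y) \<in> alt_step T"
proof -
  have T: "tournament n T"
    using assms(1) by (simp add: alternation_acyclic_def)
  obtain v x where v: "(u, v) \<in> T" "v < u" "(v, w) \<in> T" "v < w"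
    and x: "(w, x) \<in> T" "x < w" "(x, y) \<in> T" "x < y"
    using assms(2,3) by (auto simp: alt_step_iff)
  show ?thesis
  proof (cases "v < y")
    case True
    then have "(v, y) \<in> T \<or> (y, v) \<in> T"
      using tournament_total[OF T, of v y] tournament_dom[OF T] v x by auto
    moreover have "(y, v) \<notin> T"
      using no_alternating_4_cycle[OF assms(1), of y v w x] v x True by blast
    ultimately show ?thesis
      using v True by (auto simp: alt_step_iff)
  next
    case False
    then have "x < u"
      using v x by simp
    then have "(u, x) \<in> T \<or> (x, u) \<in> T"
      using tournament_total[OF T, of u x] tournament_dom[OF T] v x by auto
    moreover have "(x, u) \<notin> T"
      using no_alternating_4_cycle[OF assms(1), of u v w x] v x \<open>x < u\<close> by blast
    ultimately show ?thesis
      using x \<open>x < u\<close> by (auto simp: alt_step_iff)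
  qed
qed

lemma alt_step_irrefl: "tournament n T \<Longrightarrow> (u, u) \<notin> alt_step T"
  by (auto simp: alt_step_iff dest: tournament_asym)

text \<open>By transitivity a walk made of any positive number of descent-ascent pairs collapses to
  a single pair, so that maximality can be tested without walks.\<close>

lemma ra_walk_le_iff:
  assumes "alternation_acyclic n T"
  shows "ra_walk_le T u v \<longleftrightarrow> u = v \<or> (u, v) \<in> alt_step T"
proof
  \<comment> \<open>Writing the number of pairs as \<open>Suc i\<close> excludes the empty walk and
    lets the induction start from one pair.\<close>
  have walk: "(w 0, w (2 * Suc i)) \<in> alt_step T"
    if "\<forall>k<Suc i. (w (2 * k), w (2 * k + 1)) \<in> descents T \<and> (w (2 * k + 1), w (2 * k + 2)) \<in> ascents T"
    for w i
    using that
  proof (induction i)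
    case 0
    then show ?case by (auto simp: alt_step_def numeral_2_eq_2)
  next
    case (Suc i)
    have "(w (2 * Suc i), w (2 * Suc (Suc i))) \<in> alt_step T"
      using Suc.prems[rule_format, of "Suc i"] by (auto simp: alt_step_def)
    with Suc show ?case
      using alt_step_trans[OF assms] by (meson less_Suc_eq)
  qed
  assume "ra_walk_le T u v"
  then show "u = v \<or> (u, v) \<in> alt_step T"
    unfolding ra_walk_le_def
  proof (elim disjE exE conjE)
    fix i :: nat and w
    assume *: "1 \<le> i" "w 0 = u" "w (2 * i) = v" "\<forall>k<i. (w (2 * k), w (2 * k + 1)) \<in> descents T \<and>
               (w (2 * k + 1), w (2 * k + 2)) \<in> ascents T"
    then obtain i' where "i = Suc i'"
      by (cases i) auto
    then show ?thesis
      using walk[of i' w] * by simp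
  qed simp
next
  assume "u = v \<or> (u, v) \<in> alt_step T"
  then show "ra_walk_le T u v"
  proof
    assume "(u, v) \<in> alt_step T"
    then obtain m where "(u, m) \<in> descents T" "(m, v) \<in> ascents T"
      by (auto simp: alt_step_def)
    then have "\<exists>w :: nat \<Rightarrow> nat. w 0 = u \<and> w (2 * 1) = v \<and> (\<forall>k<1. (w (2 * k), w (2 * k + 1)) \<in> descents T \<and>
               (w (2 * k + 1), w (2 * k + 2)) \<in> ascents T)"
      by (intro exI[of _ "\<lambda>k. if k = 0 then u else if k = 1 then m else v"]) auto
    then show ?thesis
      unfolding ra_walk_le_def by blast
  qed (simp add: ra_walk_le_def)
qed

lemma maximal_elements_iff:
  assumes "alternation_acyclic n T"
  shows "m \<in> maximal_elements T S \<longleftrightarrow> m \<in> S \<and> (\<forall>x\<in>S. (m, x) \<notin> alt_step T)"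
  using assms alt_step_irrefl
  unfolding maximal_elements_def alternation_acyclic_def
  by (auto simp: ra_walk_le_iff[OF assms])

lemma maximal_elements_nonempty:
  assumes "alternation_acyclic n T" "finite S" "S \<noteq> {}"
  shows "maximal_elements T S \<noteq> {}"
proof -
  have T: "tournament n T"
    using assms(1) by (simp add: alternation_acyclic_def)
  have "\<exists>m\<in>S. \<forall>x\<in>S. (m, x) \<notin> alt_step T"
    using assms(2,3)
  proof (induction S rule: finite_ne_induct)
    case (singleton x)
    then show ?case
      using alt_step_irrefl[OF T] by simp
  next
    case (insert x F)
    then obtain m where m: "m \<in> F" "\<forall>y\<in>F. (m, y) \<notin> alt_step T"
      by blast
    \<comment> \<open>If \<open>m\<close> steps to the new element \<open>x\<close>, then
      \<open>x\<close> takes over as maximal element: a step from \<open>x\<close> to some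
      \<open>y\<close> in \<open>F\<close> would give one from \<open>m\<close> to
      \<open>y\<close>.\<close>
    then show ?case
      using alt_step_trans[OF assms(1), of m x] alt_step_irrefl[OF T, of x]
      by (cases "(m, x) \<in> alt_step T") blast+
  qed
  then show ?thesis
    using maximal_elements_iff[OF assms(1)] alt_step_irrefl assms(1)
    unfolding alternation_acyclic_def by blast
qed

section \<open>Tournaments given by a permutation and a parent function\<close>

definition descent_representation :: "nat \<Rightarrow> (nat \<Rightarrow> nat) \<Rightarrow> (nat \<Rightarrow> enat) \<Rightarrow> bool" where
  "descent_representation n \<pi> p \<longleftrightarrow> \<pi> permutes {1..n} \<and> parent_function n p \<and>
     (\<forall>k. 1 \<le> k \<and> k < n \<and> \<pi> (Suc k) < \<pi> k \<longrightarrow> enat (\<pi> (Suc k)) \<in> p ` {1..n})"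

lemma parent_functionD:
  assumes "parent_function n p" "u \<in> {1..n}" "p u = enat m"
  shows "m \<in> {1..n}" "u < m"
proof -
  have "p u \<in> enat ` {2..n} \<union> {\<infinity>}" "p u > enat u"
    using assms(1,2) by (auto simp: parent_function_def PiE_iff)
  then show "m \<in> {1..n}" "u < m"
    using assms(3) by auto
qed

lemma tournament_of_ascent_iff:
  "u < v \<Longrightarrow> (u, v) \<in> tournament_of n \<pi> p \<longleftrightarrow>
     u \<in> {1..n} \<and> v \<in> {1..n} \<and> (\<exists>m. p u = enat m \<and> inv \<pi> m \<le> inv \<pi> v)"
  by (cases "p u") (auto simp: tournament_of_def Let_def)

lemma tournament_of_descent_iff:
  "u < v \<Longrightarrow> (v, u) \<in> tournament_of n \<pi> p \<longleftrightarrow>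
     u \<in> {1..n} \<and> v \<in> {1..n} \<and> \<not> (\<exists>m. p u = enat m \<and> inv \<pi> m \<le> inv \<pi> v)"
  by (cases "p u") (auto simp: tournament_of_def Let_def)

lemma tournament_tournament_of: "tournament n (tournament_of n \<pi> p)"
  unfolding tournament_def
proof (intro conjI ballI impI)
  show "tournament_of n \<pi> p \<subseteq> {1..n} \<times> {1..n}" "irrefl (tournament_of n \<pi> p)"
    by (auto simp: tournament_of_def Let_def irrefl_def)
  fix i j
  assume "i \<in> {1..n}" "j \<in> {1..n}" "i \<noteq> j"
  then show "((i, j) \<in> tournament_of n \<pi> p) \<noteq> ((j, i) \<in> tournament_of n \<pi> p)"
    by (cases i j rule: linorder_cases)
      (auto simp: tournament_of_ascent_iff tournament_of_descent_iff)
qed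

text \<open>For a midpoint \<open>v\<close>, the descent from \<open>u\<close> says that
  \<open>p v\<close> is infinite or lies right of \<open>u\<close> in \<pi>, and the ascent to
  \<open>w\<close> says that \<open>p v\<close> is finite and lies weakly left of \<open>w\<close>.
  So a step means that the parent of a smaller vertex separates \<open>u\<close> from
  \<open>w\<close>. In particular steps go strictly to the right in \<pi>.\<close>

lemma alt_step_tournament_of_iff:
  "(u, w) \<in> alt_step (tournament_of n \<pi> p) \<longleftrightarrow> u \<in> {1..n} \<and> w \<in> {1..n} \<and>
     (\<exists>v\<in>{1..n}. v < u \<and> v < w \<and> (\<exists>m. p v = enat m \<and> inv \<pi> u < inv \<pi> m \<and> inv \<pi> m \<le> inv \<pi> w))"
  unfolding alt_step_iff
proof safe
  fix v
  assume "(u, v) \<in> tournament_of n \<pi> p" "v < u" "(v, w) \<in> tournament_of n \<pi> p" "v < w"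
  then show "u \<in> {1..n}" "w \<in> {1..n}"
    "\<exists>v\<in>{1..n}. v < u \<and> v < w \<and> (\<exists>m. p v = enat m \<and> inv \<pi> u < inv \<pi> m \<and> inv \<pi> m \<le> inv \<pi> w)"
    by (auto simp: tournament_of_ascent_iff tournament_of_descent_iff not_le intro!: bexI[of _ v])
next
  fix v m
  assume "u \<in> {1..n}" "w \<in> {1..n}" "v \<in> {1..n}" "v < u" "v < w" "p v = enat m"
    "inv \<pi> u < inv \<pi> m" "inv \<pi> m \<le> inv \<pi> w"
  then show "\<exists>v. (u, v) \<in> tournament_of n \<pi> p \<and> v < u \<and> (v, w) \<in> tournament_of n \<pi> p \<and> v < w"
    by (auto simp: tournament_of_ascent_iff tournament_of_descent_iff not_le intro!: exI[of _ v])
qed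

lemma alt_step_tournament_of_less:
  "(u, w) \<in> alt_step (tournament_of n \<pi> p) \<Longrightarrow> inv \<pi> u < inv \<pi> w"
  by (auto simp: alt_step_tournament_of_iff)

text \<open>Every descent of an alternating cycle is followed by an ascent, so moving along two arcs
  at a time raises the rank forever, although the cycle returns to its start.\<close>

lemma alternation_acyclic_if_rank:
  assumes T: "tournament n T"
    and rank: "\<And>u w. (u, w) \<in> alt_step T \<Longrightarrow> (f u :: nat) < f w"
  shows "alternation_acyclic n T"
  unfolding alternation_acyclic_def
proof (intro conjI notI)
  assume "\<exists>c. alternating_cycle T c"
  then obtain c where c: "alternating_cycle T c" ..
  let ?L = "length c" and ?g = "\<lambda>k. c ! (k mod length c)"
  have L: "0 < ?L"
    using c by (auto simp: alternating_cycle_def directed_cycle_def)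
  have arc: "cycle_arc c k = (?g k, ?g (Suc k))" for k
    by (simp add: cycle_arc_def)
  have alt: "cycle_arc c k \<in> ascents T \<and> cycle_arc c (Suc k) \<in> descents T \<or>
             cycle_arc c k \<in> descents T \<and> cycle_arc c (Suc k) \<in> ascents T" for k
  proof -
    \<comment> \<open>Alternation is assumed only for indices below the length; periodicity extends
      it to all indices.\<close>
    have "cycle_arc c (k mod ?L) = cycle_arc c k" "cycle_arc c (Suc (k mod ?L)) = cycle_arc c (Suc k)"
      by (simp_all add: cycle_arc_def mod_Suc_eq flip: Suc_eq_plus1) (metis mod_Suc_eq)+
    then show ?thesis
      using c L by (metis alternating_cycle_def mod_less_divisor)
  qed
  have disj: "e \<in> ascents T \<Longrightarrow> e \<notin> descents T" for e
    by (auto simp: ascents_def descents_def)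
  obtain k0 where k0: "cycle_arc c k0 \<in> descents T"
    using alt[of 0] by blast
  have desc: "cycle_arc c (k0 + 2 * m) \<in> descents T" for m
    by (induction m) (use k0 alt disj in \<open>auto, blast\<close>)
  have "(?g k, ?g (k + 2)) \<in> alt_step T" if "cycle_arc c k \<in> descents T" for k
  proof -
    have "cycle_arc c (Suc k) \<in> ascents T"
      using that alt[of k] disj by blast
    then show ?thesis
      using that unfolding arc alt_step_def by auto
  qed
  then have step: "f (?g (k0 + 2 * m)) < f (?g (k0 + 2 * m + 2))" for m
    using desc rank by blast
  have "f (?g k0) + m \<le> f (?g (k0 + 2 * m))" for m
  proof (induction m)
    case (Suc m)
    then show ?case
      using step[of m] by (simp add: algebra_simps)
  qed simp
  \<comment> \<open>\<open>2 * ?L\<close> arcs are two full turns, so the parity of the length does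
    not matter.\<close>
  from this[of ?L] L show False
    by (simp add: mod_add_right_eq[symmetric, of k0 "2 * ?L"])
qed (rule T)

lemma alternation_acyclic_tournament_of: "alternation_acyclic n (tournament_of n \<pi> p)"
  using tournament_tournament_of alt_step_tournament_of_less by (rule alternation_acyclic_if_rank)

text \<open>Steps only go to the right, so the last entry \<open>\<pi> k\<close> of an initial
  segment is maximal in it. A larger entry to its left is not maximal: the first smaller entry after
  it is a descent bottom, hence a parent, and the larger entry steps to it.\<close>

lemma is_largest_maximal_order_tournament_of:
  assumes "descent_representation n \<pi> p"
  shows "is_largest_maximal_order n (tournament_of n \<pi> p) \<pi>"
  unfolding is_largest_maximal_order_def
proof (intro conjI ballI)
  let ?T = "tournament_of n \<pi> p"
  show perm: "\<pi> permutes {1..n}"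
    using assms by (simp add: descent_representation_def)
  have inv: "inv \<pi> (\<pi> x) = x" for x
    by (simp add: permutes_inverses(2)[OF perm])
  have P: "\<pi> x \<in> {1..n} \<longleftrightarrow> x \<in> {1..n}" for x
    using permutes_in_image[OF perm] .
  fix k assume k: "k \<in> {1..n}"
  have max_k: "\<pi> k \<in> maximal_elements ?T (\<pi> ` {1..k})"
    using k alt_step_tournament_of_less[of "\<pi> k" _ n \<pi> p]
    by (fastforce simp: maximal_elements_iff[OF alternation_acyclic_tournament_of] inv)
  have "y \<le> \<pi> k" if "y \<in> maximal_elements ?T (\<pi> ` {1..k})" for y
  proof (rule ccontr)
    assume "\<not> y \<le> \<pi> k"
    have "y \<in> \<pi> ` {1..k}"
      using that by (simp add: maximal_elements_def)
    then obtain j where j: "1 \<le> j" "j \<le> k" "y = \<pi> j"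
      by (metis atLeastAtMost_iff imageE)
    define m where "m = (LEAST m. j < m \<and> \<pi> m < \<pi> j)"
    have "j < k \<and> \<pi> k < \<pi> j"
      using j \<open>\<not> y \<le> \<pi> k\<close> by (cases "j = k") auto
    then have m: "j < m" "\<pi> m < \<pi> j" "m \<le> k"
      unfolding m_def by (metis (mono_tags, lifting) LeastI, metis (mono_tags, lifting) LeastI, simp add: Least_le)
    \<comment> \<open>By minimality of \<open>m\<close>, the entry just before position
      \<open>m\<close> is still at least \<open>\<pi> j\<close>. Hence \<pi> descends from
      \<open>m - 1\<close> to \<open>m\<close>, and \<open>\<pi> m\<close> is the parent of some
      vertex.\<close>
    have "\<pi> j \<le> \<pi> (m - 1)"
    proof (cases "m - 1 = j")
      case False
      then have "j < m - 1" "m - 1 < m"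
        using m by auto
      then show ?thesis
        using not_less_Least[of "m - 1" "\<lambda>m. j < m \<and> \<pi> m < \<pi> j"] unfolding m_def[symmetric] by auto
    qed simp
    then have "1 \<le> m - 1 \<and> m - 1 < n \<and> \<pi> (Suc (m - 1)) < \<pi> (m - 1)"
      using m j k by auto
    then have "enat (\<pi> (Suc (m - 1))) \<in> p ` {1..n}"
      using assms unfolding descent_representation_def by blast
    then obtain v where v: "v \<in> {1..n}" "p v = enat (\<pi> m)"
      using m by auto
    then have "v < \<pi> m"
      using parent_functionD(2) assms unfolding descent_representation_def by blast
    then have "(\<pi> j, \<pi> m) \<in> alt_step ?T"
      using v m j k unfolding alt_step_tournament_of_iff P
      by (auto simp: inv intro!: bexI[of _ v])
    moreover have "\<pi> m \<in> \<pi> ` {1..k}"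
      using m j by auto
    ultimately show False
      using that j by (auto simp: maximal_elements_iff[OF alternation_acyclic_tournament_of])
  qed
  moreover have "finite (maximal_elements ?T (\<pi> ` {1..k}))"
    by (simp add: maximal_elements_def)
  ultimately show "\<pi> k = Max (maximal_elements ?T (\<pi> ` {1..k}))"
    using max_k by (intro Max_eqI[symmetric]) auto
qed

section \<open>Uniqueness and existence of representations\<close>

lemma is_largest_maximal_order_unique:
  assumes "is_largest_maximal_order n T l" "is_largest_maximal_order n T l'"
  shows "l = l'"
proof
  have perm: "l permutes {1..n}" "l' permutes {1..n}"
    using assms by (auto simp: is_largest_maximal_order_def)
  \<comment> \<open>The order is determined from its end. Equal sets of the first
    \<open>n - d\<close> values force equal values at position \<open>n - d\<close>, and removing
    these leaves equal sets again.\<close>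
  have img: "l ` {1..n - d} = l' ` {1..n - d}" for d
  proof (induction d)
    case 0
    then show ?case
      using perm permutes_image by (metis diff_zero)
  next
    case (Suc d)
    show ?case
    proof (cases "d < n")
      case True
      define k where "k = n - d"
      have k: "k \<in> {1..n}" "n - Suc d = k - 1"
        using True by (auto simp: k_def)
      then have eq: "l k = l' k"
        using assms Suc.IH unfolding is_largest_maximal_order_def k_def by metis
      have "{1..k - 1} = {1..k} - {k}"
        using k by auto
      then have "f ` {1..k - 1} = f ` {1..k} - {f k}" if "f permutes {1..n}" for f
        using permutes_inj[OF that] by (simp add: image_set_diff)
      from this[OF perm(1)] this[OF perm(2)] show ?thesis
        using Suc.IH eq unfolding k(2) k_def[symmetric] by metis
    qed (use Suc.IH in simp)
  qed
  fix x
  show "l x = l' x"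
  proof (cases "x \<in> {1..n}")
    case True
    then have "l ` {1..x} = l' ` {1..x}"
      using img[of "n - x"] by simp
    then show ?thesis
      using True assms by (simp add: is_largest_maximal_order_def)
  next
    case False
    then show ?thesis
      using perm by (metis permutes_def)
  qed
qed

lemma largest_maximal_order_eq:
  "is_largest_maximal_order n T l \<Longrightarrow> largest_maximal_order n T = l"
  unfolding largest_maximal_order_def
  by (rule the_equality) (auto intro: is_largest_maximal_order_unique)

lemma tournament_of_inj_parent:
  assumes "\<pi> permutes {1..n}" "parent_function n p" "parent_function n p'"
    "tournament_of n \<pi> p = tournament_of n \<pi> p'"
  shows "p = p'"
proof
  fix u
  have inv: "inv \<pi> x = inv \<pi> y \<Longrightarrow> x = y" for x y
    using permutes_inv[OF assms(1)] by (metis injD permutes_inj)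
  \<comment> \<open>A finite parent \<open>m\<close> of \<open>u\<close> is itself beaten by
    \<open>u\<close>, so the other parent function must place a parent of \<open>u\<close> weakly
    left of \<open>m\<close>. Used in both directions, this makes the parents equal.\<close>
  have *: "\<exists>m'. q' u = enat m' \<and> inv \<pi> m' \<le> inv \<pi> m"
    if "u \<in> {1..n}" "parent_function n q" "q u = enat m" "tournament_of n \<pi> q = tournament_of n \<pi> q'"
    for q q' m
  proof -
    have "(u, m) \<in> tournament_of n \<pi> q"
      using that(1-3) parent_functionD[OF that(2,1,3)] by (simp add: tournament_of_ascent_iff)
    then have "(u, m) \<in> tournament_of n \<pi> q'"
      using that(4) by simp
    then show ?thesis
      using parent_functionD(2)[OF that(2,1,3)] by (simp add: tournament_of_ascent_iff)
  qed
  show "p u = p' u"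
  proof (cases "u \<in> {1..n}")
    case True
    show ?thesis
    proof (cases "p u")
      case (enat m)
      then obtain m' where m': "p' u = enat m'" "inv \<pi> m' \<le> inv \<pi> m"
        using *[OF True assms(2) enat assms(4)] by blast
      then have "inv \<pi> m \<le> inv \<pi> m'"
        using *[OF True assms(3) m'(1) assms(4)[symmetric]] enat by auto
      then show ?thesis
        using m' enat inv by simp
    next
      case infinity
      then show ?thesis
        using *[OF True assms(3) _ assms(4)[symmetric]] by (cases "p' u") auto
    qed
  next
    case False
    then show ?thesis
      using assms by (simp add: parent_function_def PiE_iff extensional_def)
  qed
qed

lemma largest_maximal_parent_tournament_of:
  assumes "descent_representation n \<pi> p"
  shows "largest_maximal_parent n (tournament_of n \<pi> p) = p"
proof -
  have "largest_maximal_order n (tournament_of n \<pi> p) = \<pi>"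
    using assms by (intro largest_maximal_order_eq is_largest_maximal_order_tournament_of)
  then show ?thesis
    using assms tournament_of_inj_parent[of \<pi> n _ p] unfolding largest_maximal_parent_def descent_representation_def
    by (intro the_equality) simp_all
qed

text \<open>Both components can be recovered: the permutation is the unique largest maximal order,
  and it determines the parent function.\<close>

lemma inj_on_tournament_of: "inj_on (\<lambda>(\<pi>, p). tournament_of n \<pi> p) {(\<pi>, p). descent_representation n \<pi> p}"
proof (rule inj_onI, clarify)
  fix \<pi> p \<pi>' p'
  assume *: "descent_representation n \<pi> p" "descent_representation n \<pi>' p'" "tournament_of n \<pi> p = tournament_of n \<pi>' p'"
  then have "\<pi> = \<pi>'"
    using is_largest_maximal_order_tournament_of is_largest_maximal_order_unique by metis
  moreover have "p = p'"
    using * largest_maximal_parent_tournament_of by metis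
  ultimately show "\<pi> = \<pi>' \<and> p = p'" ..
qed

text \<open>The enumeration is built from its last value, the largest maximal element of
  \<open>S\<close>. What remains after removing it need not be an interval, hence the generalization
  to arbitrary finite sets.\<close>

lemma ex_largest_maximal_enumeration:
  assumes "alternation_acyclic n T" "finite S"
  shows "\<exists>f. bij_betw f {1..card S} S \<and> (\<forall>j\<in>{1..card S}. f j = Max (maximal_elements T (f ` {1..j})))"
  using assms(2)
proof (induction "card S" arbitrary: S)
  case 0
  then show ?case
    by (auto simp: bij_betw_def)
next
  case (Suc k)
  define m where "m = Max (maximal_elements T S)"
  have "S \<noteq> {}"
    using Suc.hyps(2) by auto
  have "finite (maximal_elements T S)"
    using Suc.prems by (simp add: maximal_elements_def)
  then have "m \<in> maximal_elements T S"
    unfolding m_def using maximal_elements_nonempty[OF assms(1) Suc.prems \<open>S \<noteq> {}\<close>]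
    by (rule Max_in)
  then have "m \<in> S"
    by (simp add: maximal_elements_def)
  then have card: "k = card (S - {m})"
    using Suc.hyps(2) Suc.prems by simp
  then obtain f where f: "bij_betw f {1..k} (S - {m})"
    "\<forall>j\<in>{1..k}. f j = Max (maximal_elements T (f ` {1..j}))"
    using Suc.hyps(1)[of "S - {m}"] Suc.prems by auto
  define g where "g = f(Suc k := m)"
  have ivl: "{1..Suc k} = insert (Suc k) {1..k}"
    by auto
  \<comment> \<open>The new value at \<open>Suc k\<close> leaves all shorter initial segments alone,
    so their conditions carry over.\<close>
  have g_f: "g ` {1..j} = f ` {1..j}" if "j \<le> k" for j
    using that by (auto simp: g_def)
  have img: "g ` {1..Suc k} = S"
    using f(1) \<open>m \<in> S\<close> g_f[of k] unfolding ivl image_insert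
    by (simp add: bij_betw_def g_def insert_absorb)
  have "bij_betw g {1..Suc k} S"
    unfolding bij_betw_def using img Suc.hyps(2) by (intro conjI eq_card_imp_inj_on) simp_all
  moreover have "g j = Max (maximal_elements T (g ` {1..j}))" if "j \<in> {1..Suc k}" for j
  proof (cases "j = Suc k")
    case True
    then show ?thesis
      using img by (simp add: g_def m_def)
  next
    case False
    then have "j \<in> {1..k}"
      using that by auto
    then show ?thesis
      using f(2) g_f[of j] by (auto simp: g_def)
  qed
  ultimately show ?case
    using Suc.hyps(2) by metis
qed

lemma ex_largest_maximal_order:
  assumes "alternation_acyclic n T"
  shows "\<exists>l. is_largest_maximal_order n T l"
proof -
  obtain f where f: "bij_betw f {1..n} {1..n}"
    "\<forall>j\<in>{1..n}. f j = Max (maximal_elements T (f ` {1..j}))"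
    using ex_largest_maximal_enumeration[OF assms, of "{1..n}"] by auto
  \<comment> \<open>\<open>permutes\<close> requires the identity outside the interval.\<close>
  define l where "l x = (if x \<in> {1..n} then f x else x)" for x
  have "bij_betw l {1..n} {1..n} \<longleftrightarrow> bij_betw f {1..n} {1..n}"
    by (rule bij_betw_cong) (simp add: l_def)
  then have "l permutes {1..n}"
    using f(1) by (intro bij_imp_permutes) (auto simp: l_def)
  moreover have "l ` {1..j} = f ` {1..j}" if "j \<le> n" for j
    using that by (auto simp: l_def)
  ultimately show ?thesis
    using f(2) unfolding is_largest_maximal_order_def by (intro exI[of _ l]) (auto simp: l_def)
qed

text \<open>The entry \<open>u\<close> is maximal among the values up to its own position, so
  \<open>w\<close> cannot be one of them.\<close>

lemma largest_maximal_order_linear_extension: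
  assumes T: "alternation_acyclic n T" and l: "is_largest_maximal_order n T l"
    and "(u, w) \<in> alt_step T"
  shows "inv l u < inv l w"
proof (rule ccontr)
  assume "\<not> inv l u < inv l w"
  have perm: "l permutes {1..n}"
    using l by (simp add: is_largest_maximal_order_def)
  have inv: "l (inv l x) = x" for x
    by (simp add: permutes_inverses[OF perm])
  have uw: "u \<in> {1..n}" "w \<in> {1..n}"
    using assms T tournament_dom unfolding alternation_acyclic_def alt_step_iff by blast+
  define k where "k = inv l u"
  have k: "k \<in> {1..n}" "inv l w \<in> {1..n}"
    using uw permutes_in_image[OF permutes_inv[OF perm]] unfolding k_def by blast+
  let ?M = "maximal_elements T (l ` {1..k})"
  have "finite ?M" "?M \<noteq> {}"
    using maximal_elements_nonempty[OF T, of "l ` {1..k}"] k by (auto simp: maximal_elements_def)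
  then have "Max ?M \<in> ?M"
    by simp
  moreover have "Max ?M = u"
    using l k inv by (metis is_largest_maximal_order_def k_def)
  moreover have "inv l w \<in> {1..k}"
    using \<open>\<not> inv l u < inv l w\<close> k by (simp add: k_def)
  then have "w \<in> l ` {1..k}"
    using inv by (metis imageI)
  ultimately show False
    using assms(3) by (auto simp: maximal_elements_iff[OF T])
qed

text \<open>The permutation is the largest maximal order \<open>l\<close>, and the parent of
  \<open>u\<close> is the leftmost head in \<open>l\<close> of an ascent from \<open>u\<close>. That
  every vertex above \<open>u\<close> and right of this parent is also beaten by \<open>u\<close>
  follows because \<open>l\<close> extends the step relation.\<close>

lemma ex_representation:
  assumes T: "alternation_acyclic n T"
  shows "\<exists>\<pi> p. descent_representation n \<pi> p \<and> tournament_of n \<pi> p = T"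
proof -
  have tour: "tournament n T"
    using T by (simp add: alternation_acyclic_def)
  obtain l where l: "is_largest_maximal_order n T l"
    using ex_largest_maximal_order[OF T] ..
  have perm: "l permutes {1..n}"
    using l by (simp add: is_largest_maximal_order_def)
  have inv: "l (inv l x) = x" "inv l (l x) = x" for x
    by (simp_all add: permutes_inverses[OF perm])
  define A where "A u = {v. (u, v) \<in> T \<and> u < v}" for u
  define p where "p u = (if u \<in> {1..n} then if A u = {} then \<infinity> else enat (l (Min (inv l ` A u))) else undefined)" for u
  have fin: "finite (A u)" for u
    by (rule finite_subset[of _ "{1..n}"]) (use tournament_dom[OF tour] in \<open>auto simp: A_def\<close>)
  have p_enat: "m \<in> A u \<and> (\<forall>v\<in>A u. inv l m \<le> inv l v)" if "u \<in> {1..n}" "p u = enat m" for u m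
  proof -
    have "A u \<noteq> {}" and m: "m = l (Min (inv l ` A u))"
      using that by (auto simp: p_def split: if_splits)
    then have "Min (inv l ` A u) \<in> inv l ` A u"
      using fin[of u] by (intro Min_in) auto
    then show ?thesis
      using fin[of u] by (auto simp: m inv)
  qed
  have p_inf: "A u = {}" if "u \<in> {1..n}" "p u = \<infinity>" for u
    using that by (auto simp: p_def split: if_splits)
  have asc: "(u, v) \<in> T \<longleftrightarrow> (\<exists>m. p u = enat m \<and> inv l m \<le> inv l v)"
    if "u \<in> {1..n}" "v \<in> {1..n}" "u < v" for u v
  proof
    assume "(u, v) \<in> T"
    then have "v \<in> A u"
      using that by (simp add: A_def)
    then show "\<exists>m. p u = enat m \<and> inv l m \<le> inv l v"
      using p_enat[OF that(1)] p_inf[OF that(1)] by (cases "p u") auto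
  next
    assume "\<exists>m. p u = enat m \<and> inv l m \<le> inv l v"
    then obtain m where "p u = enat m" "inv l m \<le> inv l v"
      by blast
    with p_enat[OF that(1)] have m: "(u, m) \<in> T" "u < m" "inv l m \<le> inv l v"
      by (auto simp: A_def)
    show "(u, v) \<in> T"
    proof (rule ccontr)
      \<comment> \<open>Then \<open>v\<close> beats \<open>u\<close> and \<open>u\<close> beats
        \<open>m\<close>, a step from \<open>v\<close> to \<open>m\<close>, although
        \<open>m\<close> is not right of \<open>v\<close>.\<close>
      assume "(u, v) \<notin> T"
      then have "(v, m) \<in> alt_step T"
        using that m tournament_total[OF tour, of u v] by (auto simp: alt_step_iff)
      then show False
        using largest_maximal_order_linear_extension[OF T l] m by force
    qed
  qed
  have eq: "tournament_of n l p = T"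
  proof (intro set_eqI, clarify)
    fix u v
    show "(u, v) \<in> tournament_of n l p \<longleftrightarrow> (u, v) \<in> T"
    proof (cases "u \<in> {1..n} \<and> v \<in> {1..n}")
      case True
      have up: "(x, y) \<in> tournament_of n l p \<longleftrightarrow> (x, y) \<in> T"
        if "x \<in> {1..n}" "y \<in> {1..n}" "x < y" for x y
        using that asc[OF that] by (simp add: tournament_of_ascent_iff)
      have total: "(x, y) \<in> R \<longleftrightarrow> (y, x) \<notin> R"
        if "tournament n R" "x \<in> {1..n}" "y \<in> {1..n}" "x < y" for x y R
        using that tournament_asym tournament_total by (metis less_irrefl)
      have "(u, u) \<notin> R" if "tournament n R" for R
        using that tournament_asym by metis
      then show ?thesis
        using up total[OF tour] total[OF tournament_tournament_of] True tour tournament_tournament_of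
        by (metis nat_neq_iff)
    next
      case False
      then show ?thesis
        using tournament_dom[OF tour] tournament_dom[OF tournament_tournament_of] by blast
    qed
  qed
  have parent: "parent_function n p"
    unfolding parent_function_def
  proof (intro conjI ballI PiE_I)
    fix u assume u: "u \<in> {1..n}"
    show "p u \<in> enat ` {2..n} \<union> {\<infinity>}" "p u > enat u"
      using u p_enat[OF u] tournament_dom[OF tour]
      by (cases "p u"; force simp: A_def)+
  qed (auto simp: p_def)
  have "enat (l (Suc k)) \<in> p ` {1..n}" if k: "1 \<le> k" "k < n" "l (Suc k) < l k" for k
  proof -
    let ?M = "maximal_elements T (l ` {1..Suc k})"
    have "l (Suc k) = Max ?M"
      using l k by (simp add: is_largest_maximal_order_def)
    moreover have "finite ?M"
      by (simp add: maximal_elements_def)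
    \<comment> \<open>The larger \<open>l k\<close> would otherwise be chosen instead of
      \<open>l (Suc k)\<close>. So it steps to an entry of this segment, and the separating parent
      lies after position \<open>k\<close> but not after \<open>Suc k\<close>.\<close>
    ultimately have "l k \<notin> ?M"
      using k by (metis Max_ge not_less)
    then obtain i where i: "i \<le> Suc k" "(l k, l i) \<in> alt_step T"
      using k by (auto simp: maximal_elements_iff[OF T])
    then obtain v m where v: "v \<in> {1..n}" "p v = enat m" "inv l (l k) < inv l m" "inv l m \<le> inv l (l i)"
      unfolding eq[symmetric] alt_step_tournament_of_iff by blast
    then have "inv l m = Suc k"
      using i(1) inv by simp
    then have "m = l (Suc k)"
      using inv by metis
    then show ?thesis
      using v by force
  qed
  then have "descent_representation n l p"
    using perm parent by (auto simp: descent_representation_def)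
  with eq show ?thesis by blast
qed

section \<open>Counting permutations with prescribed descent bottoms\<close>

definition descent_lists :: "nat \<Rightarrow> nat set \<Rightarrow> nat list set" where
  "descent_lists n S =
     {xs. distinct xs \<and> set xs = {1..n} \<and> successively (\<lambda>a b. b < a \<longrightarrow> b \<in> S) xs}"

lemma finite_descent_lists: "finite (descent_lists n S)"
  by (rule finite_subset[OF _ finite_subset_distinct[of "{1..n}"]]) (auto simp: descent_lists_def)

text \<open>The step into the maximum \<open>N\<close> is an ascent and the step out of it is a
  descent with bottom \<open>hd zs\<close>. Once \<open>hd zs\<close> is in \<open>S\<close>, the
  adjacency that \<open>N\<close> interrupts is harmless as well.\<close>

lemma successively_insert_max:
  fixes N :: "'a :: linorder"
  assumes "\<forall>x\<in>set ys \<union> set zs. x < N"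
  shows "successively (\<lambda>a b. b < a \<longrightarrow> b \<in> S) (ys @ N # zs) \<longleftrightarrow>
    successively (\<lambda>a b. b < a \<longrightarrow> b \<in> S) (ys @ zs) \<and> (zs = [] \<or> hd zs \<in> S)"
proof -
  have "ys = [] \<or> \<not> N < last ys"
    using assms last_in_set by (meson UnI1 order.asym)
  then show ?thesis
    using assms by (cases "ys = []"; cases zs) (auto simp: successively_append_iff successively_Cons)
qed

lemma descent_lists_Suc_iff:
  assumes "Suc n \<notin> set ys" "Suc n \<notin> set zs"
  shows "ys @ Suc n # zs \<in> descent_lists (Suc n) S \<longleftrightarrow>
    ys @ zs \<in> descent_lists n S \<and> (zs = [] \<or> hd zs \<in> S)"
proof -
  have "{1..Suc n} = insert (Suc n) {1..n}"
    by auto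
  then have set: "set (ys @ Suc n # zs) = {1..Suc n} \<longleftrightarrow> set (ys @ zs) = {1..n}"
    using assms insert_ident[of "Suc n" "set (ys @ zs)" "{1..n}"] by simp
  show ?thesis
  proof (cases "set (ys @ zs) = {1..n}")
    case True
    then have "\<forall>x\<in>set ys \<union> set zs. x < Suc n"
      by auto
    then show ?thesis
      using assms set True unfolding descent_lists_def
      by (auto simp: successively_insert_max)
  qed (use set in \<open>auto simp: descent_lists_def\<close>)
qed

text \<open>Position \<open>m\<close> means in front of \<open>xs ! m\<close>, and
  \<open>m = n\<close> means at the end. As \<open>xs\<close> lists every value once, the positions
  before the end correspond to the admissible values.\<close>

lemma card_insert_positions:
  assumes "xs \<in> descent_lists n S"
  shows "card {m \<in> {..n}. m = n \<or> xs ! m \<in> S} = card (S \<inter> {1..n}) + 1"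
proof -
  have xs: "distinct xs" "set xs = {1..n}"
    using assms by (auto simp: descent_lists_def)
  then have len: "length xs = n"
    using distinct_card by fastforce
  have "bij_betw ((!) xs) {m \<in> {..<n}. xs ! m \<in> S} (S \<inter> {1..n})"
  proof (rule bij_betw_imageI)
    show "inj_on ((!) xs) {m \<in> {..<n}. xs ! m \<in> S}"
      using xs(1) len by (auto simp: inj_on_def nth_eq_iff_index_eq)
    show "(!) xs ` {m \<in> {..<n}. xs ! m \<in> S} = S \<inter> {1..n}"
      unfolding xs(2)[symmetric] using len by (force simp: in_set_conv_nth)
  qed
  then have "card {m \<in> {..<n}. xs ! m \<in> S} = card (S \<inter> {1..n})"
    by (rule bij_betw_same_card)
  moreover have "{m \<in> {..n}. m = n \<or> xs ! m \<in> S} = insert n {m \<in> {..<n}. xs ! m \<in> S}"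
    by auto
  ultimately show ?thesis
    by simp
qed

lemma card_descent_lists_Suc:
  "card (descent_lists (Suc n) S) = card (descent_lists n S) * (card (S \<inter> {1..n}) + 1)"
proof -
  let ?I = "SIGMA xs : descent_lists n S. {m \<in> {..n}. m = n \<or> xs ! m \<in> S}"
  let ?f = "\<lambda>(xs, m). take m xs @ Suc n # drop m xs"
  have len: "length xs = n" "Suc n \<notin> set xs" if "xs \<in> descent_lists n S" for xs
    using that distinct_card[of xs] by (auto simp: descent_lists_def)
  have "bij_betw ?f ?I (descent_lists (Suc n) S)"
  proof (rule bij_betw_imageI)
    show "inj_on ?f ?I"
    proof (rule inj_onI, clarify)
      fix xs m xs' m'
      assume "xs \<in> descent_lists n S" "xs' \<in> descent_lists n S" "m \<le> n" "m' \<le> n"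
        and eq: "take m xs @ Suc n # drop m xs = take m' xs' @ Suc n # drop m' xs'"
      then have len': "length xs = n" "length xs' = n" "Suc n \<notin> set xs" "Suc n \<notin> set xs'" "m \<le> n" "m' \<le> n"
        using len by auto
      \<comment> \<open>The letter \<open>Suc n\<close> occurs exactly once, so it marks where the
        word splits.\<close>
      then have "take m xs = take m' xs' \<and> drop m xs = drop m' xs'"
        using eq by (intro append_Cons_eq_iff[THEN iffD1]) (auto dest: in_set_takeD in_set_dropD)
      then show "xs = xs' \<and> m = m'"
        using len' by (metis append_take_drop_id length_take min.absorb2)
    qed
    show "?f ` ?I = descent_lists (Suc n) S"
    proof (intro equalityI subsetI)
      fix xs assume "xs \<in> ?f ` ?I"
      then obtain ys m where ys: "ys \<in> descent_lists n S" "m \<le> n" "m = n \<or> ys ! m \<in> S"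
        "xs = take m ys @ Suc n # drop m ys"
        by auto
      then have "drop m ys = [] \<or> hd (drop m ys) \<in> S"
        using len(1)[OF ys(1)] by (cases "m = n") (simp_all add: hd_drop_conv_nth)
      moreover have "Suc n \<notin> set (take m ys)" "Suc n \<notin> set (drop m ys)"
        using len(2)[OF ys(1)] by (auto dest: in_set_takeD in_set_dropD)
      ultimately show "xs \<in> descent_lists (Suc n) S"
        using ys(1,4) by (simp add: descent_lists_Suc_iff)
    next
      fix xs assume xs: "xs \<in> descent_lists (Suc n) S"
      then have "Suc n \<in> set xs" "distinct xs"
        by (auto simp: descent_lists_def)
      then obtain ys zs where eq: "xs = ys @ Suc n # zs" and notin: "Suc n \<notin> set ys" "Suc n \<notin> set zs"
        by (metis distinct.simps(2) distinct_append split_list not_distinct_conv_prefix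
            split_list_first)
      then have *: "ys @ zs \<in> descent_lists n S" "zs = [] \<or> hd zs \<in> S"
        using xs descent_lists_Suc_iff by auto
      then have "length ys + length zs = n"
        using len by force
      then have "(ys @ zs, length ys) \<in> ?I"
        using * by (cases zs) auto
      then show "xs \<in> ?f ` ?I"
        using eq by (intro image_eqI[of _ _ "(ys @ zs, length ys)"]) auto
    qed
  qed
  then have "card (descent_lists (Suc n) S) = card ?I"
    by (simp add: bij_betw_same_card)
  also have "\<dots> = (\<Sum>xs\<in>descent_lists n S. card {m \<in> {..n}. m = n \<or> xs ! m \<in> S})"
    by (intro card_SigmaI) (auto intro: finite_descent_lists)
  also have "\<dots> = card (descent_lists n S) * (card (S \<inter> {1..n}) + 1)"
    using card_insert_positions by simp
  finally show ?thesis .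
qed

text \<open>Passing to one-line notation replaces \<open>p\<close> by its set of finite values,
  which is all that the descent condition sees.\<close>

lemma card_descent_representation:
  assumes "parent_function n p"
  shows "card {\<pi>. descent_representation n \<pi> p} = card (descent_lists n {v. enat v \<in> p ` {1..n}})"
proof -
  let ?f = "\<lambda>\<pi>. map \<pi> [1..<Suc n]" and ?S = "{v. enat v \<in> p ` {1..n}}"
  have succ: "successively (\<lambda>a b. b < a \<longrightarrow> b \<in> ?S) (?f \<pi>) \<longleftrightarrow>
    (\<forall>k. 1 \<le> k \<and> k < n \<and> \<pi> (Suc k) < \<pi> k \<longrightarrow> enat (\<pi> (Suc k)) \<in> p ` {1..n})" for \<pi>
  proof -
    have "successively (\<lambda>a b. b < a \<longrightarrow> b \<in> ?S) (?f \<pi>) \<longleftrightarrow>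
      (\<forall>i. Suc i < n \<longrightarrow> \<pi> (Suc (Suc i)) < \<pi> (Suc i) \<longrightarrow> enat (\<pi> (Suc (Suc i))) \<in> p ` {1..n})"
      by (simp add: successively_conv_nth del: upt_Suc)
    also have "\<dots> \<longleftrightarrow> (\<forall>k. 1 \<le> k \<and> k < n \<and> \<pi> (Suc k) < \<pi> k \<longrightarrow> enat (\<pi> (Suc k)) \<in> p ` {1..n})"
      by (metis One_nat_def Suc_le_D Suc_le_mono le0 One_nat_def)
    finally show ?thesis .
  qed
  have "bij_betw ?f {\<pi>. descent_representation n \<pi> p} (descent_lists n ?S)"
  proof (rule bij_betw_imageI)
    show "inj_on ?f {\<pi>. descent_representation n \<pi> p}"
    proof (rule inj_onI, clarify)
      fix \<pi> \<pi>'
      assume *: "descent_representation n \<pi> p" "descent_representation n \<pi>' p" "?f \<pi> = ?f \<pi>'"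
      show "\<pi> = \<pi>'"
      proof
        fix x
        show "\<pi> x = \<pi>' x"
        proof (cases "x \<in> {1..n}")
          case True
          then have "x \<in> set [1..<Suc n]"
            by auto
          then show ?thesis
            using *(3) by (metis map_eq_conv)
        next
          case False
          then show ?thesis
            using * unfolding descent_representation_def permutes_def by metis
        qed
      qed
    qed
    show "?f ` {\<pi>. descent_representation n \<pi> p} = descent_lists n ?S"
    proof (intro equalityI subsetI)
      fix xs assume "xs \<in> ?f ` {\<pi>. descent_representation n \<pi> p}"
      then obtain \<pi> where \<pi>: "xs = ?f \<pi>" "descent_representation n \<pi> p"
        by blast
      then have perm: "\<pi> permutes {1..n}"
        by (simp add: descent_representation_def)
      have "{1..<Suc n} = {1..n}"
        by auto
      then have "distinct xs" "set xs = {1..n}"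
        using permutes_image[OF perm] permutes_inj_on[OF perm] \<pi>(1)
        by (auto simp: distinct_map simp del: upt_Suc)
      then show "xs \<in> descent_lists n ?S"
        using \<pi> succ[of \<pi>] unfolding descent_lists_def descent_representation_def by blast
    next
      fix xs assume xs: "xs \<in> descent_lists n ?S"
      \<comment> \<open>List positions start at 0 and arguments of \<pi> at 1.\<close>
      define \<pi> where "\<pi> x = (if x \<in> {1..n} then xs ! (x - 1) else x)" for x
      have d: "distinct xs" "set xs = {1..n}"
        using xs by (auto simp: descent_lists_def)
      then have len: "length xs = n"
        using distinct_card by fastforce
      have f: "?f \<pi> = xs"
        by (rule nth_equalityI) (auto simp: len \<pi>_def simp del: upt_Suc)
      have "{1..<Suc n} = {1..n}"
        by auto
      then have "bij_betw \<pi> {1..n} {1..n}"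
        using arg_cong[OF f, of set] arg_cong[OF f, of distinct] d
        by (auto simp: bij_betw_def distinct_map simp del: upt_Suc)
      then have "\<pi> permutes {1..n}"
        by (rule bij_imp_permutes) (auto simp: \<pi>_def)
      then have "descent_representation n \<pi> p"
        using assms succ[of \<pi>] xs unfolding descent_representation_def descent_lists_def f by blast
      then show "xs \<in> ?f ` {\<pi>. descent_representation n \<pi> p}"
        using f by (metis imageI mem_Collect_eq)
    qed
  qed
  then show ?thesis
    by (rule bij_betw_same_card)
qed

section \<open>Extending parent functions by a largest vertex\<close>

definition roots :: "nat \<Rightarrow> (nat \<Rightarrow> enat) \<Rightarrow> nat set" where
  "roots n p = {u \<in> {1..n}. p u = \<infinity>}"

definition reroot :: "nat \<Rightarrow> (nat \<Rightarrow> enat) \<Rightarrow> nat set \<Rightarrow> nat \<Rightarrow> enat" where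
  "reroot n q X u = (if u \<in> X then enat (Suc n) else if u = Suc n then \<infinity> else q u)"

lemma finite_roots [simp]: "finite (roots n p)"
  by (simp add: roots_def)

lemma finite_parent_functions: "finite {p. parent_function n p}"
  by (rule finite_subset[OF _ finite_PiE[of "{1..n}" "\<lambda>_. enat ` {2..n} \<union> {\<infinity>}"]])
    (auto simp: parent_function_def)

lemma finite_descent_representation: "finite {\<pi>. descent_representation n \<pi> p}"
  by (rule finite_subset[OF _ finite_permutations[of "{1..n}"]]) (auto simp: descent_representation_def)

text \<open>The type depends only on the parent function, so tournaments are counted by parent
  functions, each weighted by its number of admissible permutations.\<close>

lemma acyclic_tournament_number_eq_sum:
  "int (acyclic_tournament_number n i j) =
     (\<Sum>p | parent_function n p.
        of_bool (int (card (roots n p)) = i \<and> int (card (p ` {1..n})) = j + 1) * int (card {\<pi>. descent_representation n \<pi> p}))"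
proof -
  define ty where "ty p \<longleftrightarrow> int (card (roots n p)) = i \<and> int (card (p ` {1..n})) = j + 1" for p :: "nat \<Rightarrow> enat"
  let ?S = "SIGMA p : {p. parent_function n p \<and> ty p}. {\<pi>. descent_representation n \<pi> p}"
  have type: "has_type (tournament_of n \<pi> p) n i j \<longleftrightarrow> ty p" if "descent_representation n \<pi> p" for \<pi> p
    using that by (simp add: has_type_def ty_def roots_def largest_maximal_parent_tournament_of)
  have "bij_betw (\<lambda>(p, \<pi>). tournament_of n \<pi> p) ?S {T. alternation_acyclic n T \<and> has_type T n i j}"
  proof (rule bij_betw_imageI)
    show "inj_on (\<lambda>(p, \<pi>). tournament_of n \<pi> p) ?S"
      using inj_on_tournament_of[of n] by (auto simp: inj_on_def)
    show "(\<lambda>(p, \<pi>). tournament_of n \<pi> p) ` ?S = {T. alternation_acyclic n T \<and> has_type T n i j}"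
    proof (intro equalityI subsetI)
      fix T assume T: "T \<in> {T. alternation_acyclic n T \<and> has_type T n i j}"
      then obtain \<pi> p where *: "descent_representation n \<pi> p" "tournament_of n \<pi> p = T"
        using ex_representation by blast
      then have "(p, \<pi>) \<in> ?S"
        using T type by (auto simp: descent_representation_def)
      then show "T \<in> (\<lambda>(p, \<pi>). tournament_of n \<pi> p) ` ?S"
        using * by (intro image_eqI[of _ _ "(p, \<pi>)"]) auto
    qed (auto simp: type alternation_acyclic_tournament_of)
  qed
  then have "acyclic_tournament_number n i j = card ?S"
    by (simp add: acyclic_tournament_number_def bij_betw_same_card)
  also have "\<dots> = (\<Sum>p | parent_function n p \<and> ty p. card {\<pi>. descent_representation n \<pi> p})"
    using finite_parent_functions[of n] finite_descent_representation by (intro card_SigmaI) auto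
  also have "int \<dots> = (\<Sum>p | parent_function n p. of_bool (ty p) * int (card {\<pi>. descent_representation n \<pi> p}))"
    unfolding of_nat_sum using finite_parent_functions[of n]
    by (intro sum.mono_neutral_cong_left) auto
  finally show ?thesis
    by (simp add: ty_def)
qed

lemma parent_function_value:
  assumes "parent_function n q" "u \<in> {1..n}"
  shows "q u \<noteq> enat (Suc n)"
  using parent_functionD(1)[OF assms] by fastforce

lemma bij_betw_reroot:
  "bij_betw (\<lambda>(q, X). reroot n q X) (SIGMA q : {q. parent_function n q}. Pow (roots n q))
     {p. parent_function (Suc n) p}"
proof (rule bij_betw_imageI)
  let ?S = "SIGMA q : {q. parent_function n q}. Pow (roots n q)"
  have sub: "X \<subseteq> roots n q \<Longrightarrow> u \<in> X \<Longrightarrow> u \<in> {1..n} \<and> q u = \<infinity>" for X q u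
    by (auto simp: roots_def)
  show "inj_on (\<lambda>(q, X). reroot n q X) ?S"
  proof (rule inj_on_inverseI)
    \<comment> \<open>The inverse: \<open>X\<close> is the set of children of \<open>Suc n\<close>,
      and turning them back into roots gives \<open>q\<close>.\<close>
    let ?g = "\<lambda>p. (restrict (\<lambda>u. if p u = enat (Suc n) then \<infinity> else p u) {1..n}, {u \<in> {1..n}. p u = enat (Suc n)})"
    fix qX assume "qX \<in> ?S"
    then obtain q X where qX: "qX = (q, X)" "parent_function n q" "X \<subseteq> roots n q"
      by auto
    have "restrict (\<lambda>u. if reroot n q X u = enat (Suc n) then \<infinity> else reroot n q X u) {1..n} u = q u" for u
    proof (cases "u \<in> {1..n}")
      case True
      then show ?thesis
        using sub[OF qX(3)] parent_function_value[OF qX(2)] by (auto simp: reroot_def)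
    next
      case False
      then show ?thesis
        using qX(2) by (auto simp: parent_function_def PiE_iff extensional_def)
    qed
    moreover have "{u \<in> {1..n}. reroot n q X u = enat (Suc n)} = X"
      using sub[OF qX(3)] parent_function_value[OF qX(2)] by (auto simp: reroot_def)
    ultimately show "?g ((\<lambda>(q, X). reroot n q X) qX) = qX"
      unfolding qX(1) by auto
  qed
  show "(\<lambda>(q, X). reroot n q X) ` ?S = {p. parent_function (Suc n) p}"
  proof (intro equalityI subsetI)
    fix p assume "p \<in> (\<lambda>(q, X). reroot n q X) ` ?S"
    then obtain q X where q: "p = reroot n q X" "parent_function n q" "X \<subseteq> roots n q"
      by auto
    have "p u \<in> enat ` {2..Suc n} \<union> {\<infinity>} \<and> p u > enat u" if "u \<in> {1..Suc n}" for u
    proof (cases "u \<in> X \<or> u = Suc n")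
      case True
      then show ?thesis
        using sub[OF q(3), of u] by (auto simp: q(1) reroot_def)
    next
      case False
      then have "u \<in> {1..n}"
        using that by auto
      then have "q u \<in> enat ` {2..n} \<union> {\<infinity>}" "q u > enat u"
        using q(2) by (auto simp: parent_function_def PiE_iff)
      then show ?thesis
        using False by (auto simp: q(1) reroot_def)
    qed
    moreover have "p u = undefined" if "u \<notin> {1..Suc n}" for u
      using that sub[OF q(3), of u] q(2)
      by (auto simp: q(1) reroot_def parent_function_def PiE_iff extensional_def)
    ultimately show "p \<in> {p. parent_function (Suc n) p}"
      unfolding parent_function_def by (intro CollectI conjI PiE_I) blast+
  next
    fix p assume *: "p \<in> {p. parent_function (Suc n) p}"
    then have p: "p u \<in> enat ` {2..Suc n} \<union> {\<infinity>}" "p u > enat u" if "u \<in> {1..Suc n}" for u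
      using that by (auto simp: parent_function_def PiE_iff)
    have undef: "p u = undefined" if "u \<notin> {1..Suc n}" for u
      using * that by (simp add: parent_function_def PiE_iff extensional_def)
    define X where "X = {u \<in> {1..n}. p u = enat (Suc n)}"
    define q where "q = restrict (\<lambda>u. if p u = enat (Suc n) then \<infinity> else p u) {1..n}"
    have "parent_function n q"
      unfolding parent_function_def
    proof (intro conjI ballI PiE_I)
      fix u assume u: "u \<in> {1..n}"
      then have "p u \<in> enat ` {2..Suc n} \<union> {\<infinity>}" "p u > enat u"
        using p by auto
      then show "q u \<in> enat ` {2..n} \<union> {\<infinity>}" "q u > enat u"
        using u by (auto simp: q_def le_Suc_eq)
    qed (auto simp: q_def)
    moreover have "X \<subseteq> roots n q"
      by (auto simp: X_def roots_def q_def)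
    moreover have "p = reroot n q X"
    proof
      fix u
      consider "u \<in> {1..n}" | "u = Suc n" | "u \<notin> {1..Suc n}"
        by fastforce
      then show "p u = reroot n q X u"
      proof cases
        case 2
        then have "p u = \<infinity>"
          using p[of u] by auto
        then show ?thesis
          using 2 by (simp add: reroot_def X_def)
      qed (auto simp: reroot_def X_def q_def undef)
    qed
    ultimately show "p \<in> (\<lambda>(q, X). reroot n q X) ` ?S"
      by (intro image_eqI[of _ _ "(q, X)"]) auto
  qed
qed

context
  fixes n q X
  assumes n: "1 \<le> n" and q: "parent_function n q" and X: "X \<subseteq> roots n q"
begin

lemma infinity_in_parent_range: "\<infinity> \<in> q ` {1..n}"
proof -
  have "q n = \<infinity>"
    using parent_functionD[OF q, of n] n by (cases "q n") fastforce+
  then show ?thesis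
    using n by force
qed

lemma reroot_range:
  "reroot n q X ` {1..Suc n} = q ` {1..n} \<union> (if X = {} then {} else {enat (Suc n)})"
proof -
  have sub: "u \<in> {1..n} \<and> q u = \<infinity>" if "u \<in> X" for u
    using that X by (auto simp: roots_def)
  have ivl: "{1..Suc n} = insert (Suc n) {1..n}"
    by auto
  \<comment> \<open>Even if every root of \<open>q\<close> lies in \<open>X\<close>, infinity stays
    in the range, because \<open>Suc n\<close> is a root.\<close>
  have "reroot n q X ` {1..Suc n} = insert \<infinity> (reroot n q X ` {1..n})"
    unfolding ivl using sub[of "Suc n"] by (auto simp: reroot_def)
  also have "\<dots> = insert \<infinity> (q ` {1..n}) \<union> (if X = {} then {} else {enat (Suc n)})"
  proof -
    have "reroot n q X ` {1..n} = reroot n q X ` ({1..n} - X) \<union> reroot n q X ` X"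
      using sub by blast
    moreover have "reroot n q X ` ({1..n} - X) = q ` ({1..n} - X)"
      by (intro image_cong) (auto simp: reroot_def)
    moreover have "reroot n q X ` X = (if X = {} then {} else {enat (Suc n)})"
      by (auto simp: reroot_def)
    moreover have "insert \<infinity> (q ` {1..n}) = insert \<infinity> (q ` ({1..n} - X))"
      using sub by (auto simp: image_iff)
    ultimately show ?thesis
      by auto
  qed
  also have "insert \<infinity> (q ` {1..n}) = q ` {1..n}"
    using infinity_in_parent_range by (rule insert_absorb)
  finally show ?thesis .
qed

lemma card_reroot_range:
  "card (reroot n q X ` {1..Suc n}) = card (q ` {1..n}) + of_bool (X \<noteq> {})"
proof -
  have "enat (Suc n) \<notin> q ` {1..n}"
    using parent_function_value[OF q] by force
  then show ?thesis
    unfolding reroot_range by simp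
qed

lemma card_roots_reroot: "int (card (roots (Suc n) (reroot n q X))) = int (card (roots n q)) - int (card X) + 1"
proof -
  have sub: "u \<in> {1..n} \<and> q u = \<infinity>" if "u \<in> X" for u
    using that X by (auto simp: roots_def)
  have "roots (Suc n) (reroot n q X) = insert (Suc n) (roots n q - X)"
    using sub[of "Suc n"] by (auto simp: roots_def reroot_def split: if_splits)
  moreover have "Suc n \<notin> roots n q"
    by (simp add: roots_def)
  moreover have "card X \<le> card (roots n q)" "finite X"
    using X finite_subset[OF X] by (auto intro: card_mono)
  ultimately show ?thesis
    using X by (simp add: card_Diff_subset)
qed

text \<open>Up to \<open>n\<close>, the finite values of the extended function are those of
  \<open>q\<close>. So deleting \<open>Suc n\<close> leaves a word counted for \<open>q\<close>, and
  the insertion factor does not depend on \<open>X\<close>.\<close>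

lemma card_descent_representation_reroot:
  "card {\<pi>. descent_representation (Suc n) \<pi> (reroot n q X)} = card {\<pi>. descent_representation n \<pi> q} * card (q ` {1..n})"
proof -
  define S where "S = {v. enat v \<in> q ` {1..n}}"
  define S' where "S' = {v. enat v \<in> reroot n q X ` {1..Suc n}}"
  have p: "parent_function (Suc n) (reroot n q X)"
    using bij_betwE[OF bij_betw_reroot, of n] q X by auto
  have sub: "S \<subseteq> {1..n}"
  proof
    fix v assume "v \<in> S"
    then obtain u where "u \<in> {1..n}" "q u = enat v"
      unfolding S_def by (metis imageE mem_Collect_eq)
    then show "v \<in> {1..n}"
      using parent_functionD(1)[OF q] by blast
  qed
  have "S' \<inter> {1..n} = S"
    using sub unfolding S'_def reroot_range by (auto simp: S_def)
  moreover have "descent_lists n S' = descent_lists n (S' \<inter> {1..n})"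
    unfolding descent_lists_def by (intro Collect_cong conj_cong refl successively_cong) auto
  \<comment> \<open>The extra 1 is infinity in the range; among the insertion positions it is the
    end of the word.\<close>
  moreover have "card S + 1 = card (q ` {1..n})"
  proof -
    have "q ` {1..n} = insert \<infinity> (enat ` S)"
    proof (intro equalityI subsetI)
      fix x assume "x \<in> q ` {1..n}"
      then show "x \<in> insert \<infinity> (enat ` S)"
        by (cases x) (auto simp: S_def)
    qed (use infinity_in_parent_range in \<open>auto simp: S_def\<close>)
    moreover have "finite S"
      using sub finite_subset by blast
    moreover have "card (enat ` S) = card S" "\<infinity> \<notin> enat ` S"
      by (auto simp: card_image inj_on_def)
    ultimately show ?thesis
      by simp
  qed
  ultimately show ?thesis
    using card_descent_representation[OF p] card_descent_representation[OF q]
      card_descent_lists_Suc[of n S'] by (simp add: S_def S'_def)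
qed

end

section \<open>Choosing the new children and the recurrence\<close>

lemma card_subsets_codim:
  assumes "finite Z"
  shows "int (card {X \<in> Pow Z. X \<noteq> {} \<and> int (card Z) - int (card X) + 1 = i}) =
    of_bool (i \<le> int (card Z)) * int_binomial (int (card Z)) (i - 1)"
proof (cases "1 \<le> i \<and> i \<le> int (card Z)")
  case True
  define r where "r = nat (i - 1)"
  have r: "i = int r + 1" "r < card Z"
    using True by (auto simp: r_def)
  \<comment> \<open>With \<open>r = i - 1\<close> the complement of \<open>X\<close> has
    \<open>r\<close> elements, and \<open>X\<close> is nonempty automatically because
    \<open>r < card Z\<close>. Symmetry of the binomial then gives lower index
    \<open>i - 1\<close>.\<close>
  have "{X \<in> Pow Z. X \<noteq> {} \<and> int (card Z) - int (card X) + 1 = i} = {X. X \<subseteq> Z \<and> card X = card Z - r}"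
    using r assms by auto
  then have "card {X \<in> Pow Z. X \<noteq> {} \<and> int (card Z) - int (card X) + 1 = i} = card Z choose r"
    using n_subsets[OF assms, of "card Z - r"] binomial_symmetric[of r "card Z"] r by simp
  then show ?thesis
    using r by (simp add: int_binomial_def)
next
  case False
  \<comment> \<open>Inclusion in \<open>Z\<close> forces the value to be at least 1, and
    nonemptiness forces it to be at most \<open>card Z\<close>. For \<open>i < 1\<close> the right
    side vanishes by the convention for negative lower indices.\<close>
  have "int (card Z) - int (card X) + 1 \<noteq> i" if "X \<subseteq> Z" "X \<noteq> {}" for X
  proof -
    have "card X \<le> card Z"
      using that(1) assms by (simp add: card_mono)
    moreover have "0 < card X"
      using that finite_subset[OF that(1) assms] by (simp add: card_gt_0_iff)
    ultimately show ?thesis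
      using False by linarith
  qed
  then have empty: "{X \<in> Pow Z. X \<noteq> {} \<and> int (card Z) - int (card X) + 1 = i} = {}"
    by blast
  show ?thesis
    unfolding empty using False by (auto simp: int_binomial_def)
qed

text \<open>The empty \<open>X\<close> adds one root and keeps the range; a nonempty
  \<open>X\<close> adds \<open>Suc n\<close> to the range.\<close>

lemma card_reroot_choices:
  assumes "1 \<le> n" "parent_function n q"
  shows "(\<Sum>X\<in>Pow (roots n q). of_bool (int (card (roots (Suc n) (reroot n q X))) = i \<and>
            int (card (reroot n q X ` {1..Suc n})) = j + 1)) =
    of_bool (int (card (roots n q)) = i - 1 \<and> int (card (q ` {1..n})) = j + 1) +
    of_bool (i \<le> int (card (roots n q)) \<and> int (card (q ` {1..n})) = j) * int_binomial (int (card (roots n q))) (i - 1)"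
proof -
  let ?Z = "roots n q" and ?c = "int (card (q ` {1..n}))"
  have "(\<Sum>X\<in>Pow ?Z. of_bool (int (card (roots (Suc n) (reroot n q X))) = i \<and>
            int (card (reroot n q X ` {1..Suc n})) = j + 1)) =
     (\<Sum>X\<in>Pow ?Z. of_bool (int (card ?Z) - int (card X) + 1 = i \<and> ?c + of_bool (X \<noteq> {}) = j + 1) :: int)"
    using card_roots_reroot[OF assms] card_reroot_range[OF assms] by (intro sum.cong) auto
  also have "\<dots> = of_bool (int (card ?Z) + 1 = i \<and> ?c = j + 1) +
     (\<Sum>X\<in>Pow ?Z - {{}}. of_bool (int (card ?Z) - int (card X) + 1 = i \<and> ?c = j))"
    by (subst sum.remove[of _ "{}"]) auto
  also have "(\<Sum>X\<in>Pow ?Z - {{}}. of_bool (int (card ?Z) - int (card X) + 1 = i \<and> ?c = j)) =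
     of_bool (?c = j) * int (card {X \<in> Pow ?Z. X \<noteq> {} \<and> int (card ?Z) - int (card X) + 1 = i})"
  proof -
    have "{X \<in> Pow ?Z. X \<noteq> {} \<and> int (card ?Z) - int (card X) + 1 = i} =
      {X \<in> Pow ?Z - {{}}. int (card ?Z) - int (card X) + 1 = i}"
      by auto
    moreover have "(\<Sum>X\<in>A. of_bool (P X \<and> b)) = (of_bool b * int (card {X \<in> A. P X}))"
      if "finite A" for A :: "nat set set" and P b
      using that by (auto simp: Int_def)
    ultimately show ?thesis
      by simp
  qed
  also note card_subsets_codim[OF finite_roots]
  also have "of_bool (int (card ?Z) + 1 = i \<and> ?c = j + 1) +
      of_bool (?c = j) * (of_bool (i \<le> int (card ?Z)) * int_binomial (int (card ?Z)) (i - 1)) =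
    of_bool (int (card ?Z) = i - 1 \<and> ?c = j + 1) +
    of_bool (i \<le> int (card ?Z) \<and> ?c = j) * int_binomial (int (card ?Z)) (i - 1)"
    by auto
  finally show ?thesis .
qed

lemma acyclic_tournament_number_Suc:
  assumes "1 \<le> n"
  shows "int (acyclic_tournament_number (Suc n) i j) =
    (\<Sum>k = i..int n. int_binomial k (i - 1) * j * int (acyclic_tournament_number n k (j - 1)))
    + (j + 1) * int (acyclic_tournament_number n (i - 1) j)"
proof -
  let ?P = "{q. parent_function n q}"
  let ?z = "\<lambda>q. int (card (roots n q))" and ?c = "\<lambda>q. int (card (q ` {1..n}))"
    and ?W = "\<lambda>q. int (card {\<pi>. descent_representation n \<pi> q})"
  let ?ty = "\<lambda>p. of_bool (int (card (roots (Suc n) p)) = i \<and> int (card (p ` {1..Suc n})) = j + 1) :: int"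
  have "int (acyclic_tournament_number (Suc n) i j) =
    (\<Sum>p | parent_function (Suc n) p. ?ty p * int (card {\<pi>. descent_representation (Suc n) \<pi> p}))"
    by (rule acyclic_tournament_number_eq_sum)
  also have "\<dots> = (\<Sum>(q, X)\<in>(SIGMA q : ?P. Pow (roots n q)).
     ?ty (reroot n q X) * int (card {\<pi>. descent_representation (Suc n) \<pi> (reroot n q X)}))"
    by (subst sum.reindex_bij_betw[OF bij_betw_reroot, symmetric]) (simp add: case_prod_beta)
  also have "\<dots> = (\<Sum>q\<in>?P. \<Sum>X\<in>Pow (roots n q).
     ?ty (reroot n q X) * int (card {\<pi>. descent_representation (Suc n) \<pi> (reroot n q X)}))"
    using finite_parent_functions by (intro sum.Sigma[symmetric]) auto
  \<comment> \<open>The weight is independent of \<open>X\<close>, so the inner sum only counts the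
    choices of \<open>X\<close> with the right type.\<close>
  also have "\<dots> = (\<Sum>q\<in>?P. (\<Sum>X\<in>Pow (roots n q). ?ty (reroot n q X)) * (?c q * ?W q))"
    unfolding sum_distrib_right using card_descent_representation_reroot[OF assms] by (intro sum.cong refl) auto
  also have "\<dots> = (\<Sum>q\<in>?P. of_bool (?z q = i - 1 \<and> ?c q = j + 1) * (?c q * ?W q)) +
     (\<Sum>q\<in>?P. of_bool (i \<le> ?z q \<and> ?c q = j) * int_binomial (?z q) (i - 1) * (?c q * ?W q))"
    unfolding sum.distrib[symmetric] using card_reroot_choices[OF assms]
    by (intro sum.cong) (auto simp: distrib_right)
  \<comment> \<open>The insertion factor is the size of the range of \<open>q\<close>: here
    \<open>j + 1\<close>, and \<open>j\<close> in the other sum.\<close>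
  also have "(\<Sum>q\<in>?P. of_bool (?z q = i - 1 \<and> ?c q = j + 1) * (?c q * ?W q)) =
     (j + 1) * int (acyclic_tournament_number n (i - 1) j)"
    unfolding acyclic_tournament_number_eq_sum sum_distrib_left by (intro sum.cong) auto
  \<comment> \<open>The parent functions are sorted by their number \<open>k\<close> of roots, and
    \<open>j - 1 + 1\<close> is left in the form of type index \<open>j - 1\<close>.\<close>
  also have "(\<Sum>q\<in>?P. of_bool (i \<le> ?z q \<and> ?c q = j) * int_binomial (?z q) (i - 1) * (?c q * ?W q)) =
     (\<Sum>q\<in>?P. \<Sum>k = i..int n. int_binomial k (i - 1) * j * (of_bool (?z q = k \<and> ?c q = j - 1 + 1) * ?W q))"
  proof (intro sum.cong refl)
    fix q
    \<comment> \<open>There are at most \<open>n\<close> roots, so the upper summation limit cuts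
      nothing off.\<close>
    have "card (roots n q) \<le> card {1..n}"
      by (intro card_mono) (auto simp: roots_def)
    then have "?z q \<in> {i..int n} \<longleftrightarrow> i \<le> ?z q"
      by simp
    moreover have "(\<Sum>k = i..int n. int_binomial k (i - 1) * j * (of_bool (?z q = k \<and> ?c q = j - 1 + 1) * ?W q)) =
      (\<Sum>k = i..int n. if ?z q = k then int_binomial (?z q) (i - 1) * j * (of_bool (?c q = j) * ?W q) else 0)"
      by (intro sum.cong) auto
    ultimately show "of_bool (i \<le> ?z q \<and> ?c q = j) * int_binomial (?z q) (i - 1) * (?c q * ?W q) =
      (\<Sum>k = i..int n. int_binomial k (i - 1) * j * (of_bool (?z q = k \<and> ?c q = j - 1 + 1) * ?W q))"
      by (simp add: sum.delta')
  qed
  also have "\<dots> = (\<Sum>k = i..int n. int_binomial k (i - 1) * j * int (acyclic_tournament_number n k (j - 1)))"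
    unfolding acyclic_tournament_number_eq_sum sum_distrib_left by (rule sum.swap)
  finally show ?thesis
    by simp
qed

lemma acyclic_tournament_number_1:
  "int (acyclic_tournament_number 1 i j) = of_bool (i = 1) * of_bool (0 = j)"
proof -
  define p\<^sub>0 :: "nat \<Rightarrow> enat" where "p\<^sub>0 = restrict (\<lambda>_. \<infinity>) {1}"
  have "parent_function 1 p \<longleftrightarrow> p = p\<^sub>0" for p
    by (auto simp: parent_function_def p\<^sub>0_def PiE_iff extensional_def restrict_def)
  then have P: "{p. parent_function 1 p} = {p\<^sub>0}" and p\<^sub>0: "parent_function 1 p\<^sub>0"
    by auto
  have "{\<pi>. descent_representation 1 \<pi> p\<^sub>0} = {id}"
    using p\<^sub>0 by (auto simp: descent_representation_def)
  moreover have "roots 1 p\<^sub>0 = {1}"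
    by (auto simp: roots_def p\<^sub>0_def)
  ultimately show ?thesis
    unfolding acyclic_tournament_number_eq_sum P by (auto simp: p\<^sub>0_def)
qed

theorem theorem5p7:
  shows "(\<forall>i j :: int. int (acyclic_tournament_number 1 i j) = of_bool (i = 1) * of_bool (0 = j)) \<and>
    (\<forall>n \<ge> 2. \<forall>i j :: int.
       int (acyclic_tournament_number n i j) =
         (\<Sum>k = i..int n - 1. int_binomial k (i - 1) * j * int (acyclic_tournament_number (n - 1) k (j - 1)))
         + (j + 1) * int (acyclic_tournament_number (n - 1) (i - 1) j))"
proof (intro conjI allI impI)
  fix n :: nat and i j :: int
  assume "2 \<le> n"
  then obtain m where "n = Suc m" "1 \<le> m"
    by (cases n) auto
  then show "int (acyclic_tournament_number n i j) =
         (\<Sum>k = i..int n - 1. int_binomial k (i - 1) * j * int (acyclic_tournament_number (n - 1) k (j - 1)))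
         + (j + 1) * int (acyclic_tournament_number (n - 1) (i - 1) j)"
    using acyclic_tournament_number_Suc[of m i j] by simp
qed (rule acyclic_tournament_number_1)

end
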